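(* The isomorphism relation on countable weakly-connected vertex-transitive directed graphs is Borel complete. That is, for every countable relational language $L$ there is a Borel function $f$ from $\mathrm{Mod}(L)$ into the standard Borel space of directed graphs with vertex set $\mathbb{N}$ such that for every $A\in\mathrm{Mod}(L)$ the directed graph $f(A)$ is weakly connected and vertex-transitive, and for all $A,B\in\mathrm{Mod}(L)$ we have $A\cong B$ if and only if $f(A)\cong f(B)$.
   Context: A directed graph is an oriented simple graph: an irreflexive relation $\to$ on the vertex set such that $x\to y$ and $y\to x$ never both hold. It is weakly connected if the underlying undirected graph is connected. A structure is vertex-transitive if its automorphism group acts transitively on its underlying set. For a countable relational language $L$, $\mathrm{Mod}(L)$ is the standard Borel space of $L$-structures with universe $\mathbb{N}$. An equivalence relation $E$ (possibly on a non-Borel class of structures) is Borel complete if for every countable relational language $L$, isomorphism on $\mathrm{Mod}(L)$ is Borel reducible to $E$, i.e. there is a Borel map $f$ with $A\cong B\iff f(A)\mathrel{E}f(B)$. *)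

theory Defs
  imports "HOL-Analysis.Analysis"
begin

text \<open>
  A relational language is a set \<open>L\<close> of relation symbols with an arity function \<open>ar\<close>.
  A structure with universe \<open>\<nat>\<close> assigns a truth value to each atomic fact \<open>(R, xs)\<close>, so
  \<open>Mod(L)\<close> is the product of the discrete two-point spaces over all atomic facts. For
  countable \<open>L\<close> this is a countable product, so the product \<open>\<sigma>\<close>-algebra is the Borel one.
\<close>

definition atoms :: "'r set \<Rightarrow> ('r \<Rightarrow> nat) \<Rightarrow> ('r \<times> nat list) set" where
  "atoms L ar = {(R, xs). R \<in> L \<and> length xs = ar R}"

definition Mod :: "'r set \<Rightarrow> ('r \<Rightarrow> nat) \<Rightarrow> ('r \<times> nat list \<Rightarrow> bool) measure" where
  "Mod L ar = PiM (atoms L ar) (\<lambda>_. count_space UNIV)"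

definition struct_iso ::
  "'r set \<Rightarrow> ('r \<Rightarrow> nat) \<Rightarrow> ('r \<times> nat list \<Rightarrow> bool) \<Rightarrow> ('r \<times> nat list \<Rightarrow> bool) \<Rightarrow> bool" where
  "struct_iso L ar A B \<longleftrightarrow>
     (\<exists>\<pi>. bij \<pi> \<and> (\<forall>R\<in>L. \<forall>xs. length xs = ar R \<longrightarrow> A (R, xs) = B (R, map \<pi> xs)))"

definition digraph :: "('v \<times> 'v \<Rightarrow> bool) \<Rightarrow> bool" where
  "digraph G \<longleftrightarrow> (\<forall>x. \<not> G (x, x)) \<and> (\<forall>x y. \<not> (G (x, y) \<and> G (y, x)))"

definition digraph_space :: "(nat \<times> nat \<Rightarrow> bool) measure" where
  "digraph_space = restrict_space (PiM UNIV (\<lambda>_. count_space UNIV)) {G. digraph G}"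

definition weakly_connected :: "('v \<times> 'v \<Rightarrow> bool) \<Rightarrow> bool" where
  "weakly_connected G \<longleftrightarrow> (\<forall>x y. (\<lambda>u v. G (u, v) \<or> G (v, u))\<^sup>*\<^sup>* x y)"

definition digraph_isomorphism ::
  "('v \<times> 'v \<Rightarrow> bool) \<Rightarrow> ('w \<times> 'w \<Rightarrow> bool) \<Rightarrow> ('v \<Rightarrow> 'w) \<Rightarrow> bool" where
  "digraph_isomorphism G H \<pi> \<longleftrightarrow> bij \<pi> \<and> (\<forall>x y. G (x, y) = H (\<pi> x, \<pi> y))"

definition digraph_iso :: "('v \<times> 'v \<Rightarrow> bool) \<Rightarrow> ('w \<times> 'w \<Rightarrow> bool) \<Rightarrow> bool" where
  "digraph_iso G H \<longleftrightarrow> (\<exists>\<pi>. digraph_isomorphism G H \<pi>)"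

definition vertex_transitive :: "('v \<times> 'v \<Rightarrow> bool) \<Rightarrow> bool" where
  "vertex_transitive G \<longleftrightarrow> (\<forall>x y. \<exists>\<pi>. digraph_isomorphism G G \<pi> \<and> \<pi> x = y)"

end

theory Submission
  imports Defs "HOL-Library.Poly_Mapping"
begin

text \<open>
  Let \<open>\<Gamma>\<close> be an oriented graph on a countable set \<open>V\<close>, and let \<open>S\<close> consist of the basis elements
  \<open>e\<^sub>x\<close> of the free abelian group on \<open>V\<close> together with \<open>e\<^sub>y - e\<^sub>x\<close> for every edge \<open>x \<rightarrow> y\<close>. The Cayley
  digraph of \<open>S\<close> is weakly connected and vertex-transitive. Since it is vertex-transitive, its
  isomorphism type determines the digraph induced on the out-neighbourhood \<open>S\<close> of \<open>0\<close>. There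
  \<open>e\<^sub>x \<rightarrow> e\<^sub>y\<close> holds iff \<open>x \<rightarrow> y\<close>, and if \<open>\<Gamma>\<close> has no transitive triangles then each \<open>e\<^sub>y - e\<^sub>x\<close> is a
  source with \<open>e\<^sub>y\<close> as its only out-neighbour. Hence \<open>\<Gamma>\<close> is recovered whenever it has no such vertices
  itself, and it remains to code structures by digraphs of this kind.
\<close>

section \<open>Digraph isomorphisms\<close>

lemma bij_Ex1_iff:
  assumes "bij f"
  shows "(\<exists>!x. P (f x)) \<longleftrightarrow> (\<exists>!y. P y)"
proof
  assume "\<exists>!x. P (f x)"
  then obtain x where x: "P (f x)" "\<And>z. P (f z) \<Longrightarrow> z = x" by blast
  have "y = f x" if "P y" for y
    using x(2) that assms by (metis bij_pointE)
  with x(1) show "\<exists>!y. P y" by blast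
next
  assume "\<exists>!y. P y"
  then obtain y where y: "P y" "\<And>z. P z \<Longrightarrow> z = y" by blast
  obtain x where x: "y = f x" using assms by (metis bij_pointE)
  have "z = x" if "P (f z)" for z
    using y(2)[OF that] x bij_is_inj[OF assms] by (simp add: inj_eq)
  with x y(1) show "\<exists>!x. P (f x)" by blast
qed

lemma digraph_isomorphism_comp:
  assumes "digraph_isomorphism G H \<phi>" "digraph_isomorphism H K \<psi>"
  shows "digraph_isomorphism G K (\<psi> \<circ> \<phi>)"
  using assms by (auto simp: digraph_isomorphism_def intro: bij_comp)

lemma digraph_isomorphism_inv:
  assumes "digraph_isomorphism G H \<phi>"
  shows "digraph_isomorphism H G (inv \<phi>)"
  using assms unfolding digraph_isomorphism_def
  by (metis bij_betw_inv_into bij_inv_eq_iff)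

text \<open>Along a bijection this is transport of structure. It moves a Cayley digraph from the
  free abelian group to the vertex set of naturals.\<close>

definition pullback :: "('w \<Rightarrow> 'v) \<Rightarrow> ('v \<times> 'v \<Rightarrow> bool) \<Rightarrow> 'w \<times> 'w \<Rightarrow> bool" where
  "pullback h G = G \<circ> map_prod h h"

lemma pullback_apply [simp]: "pullback h G (x, y) = G (h x, h y)"
  by (simp add: pullback_def)

lemma digraph_isomorphism_pullback: "bij h \<Longrightarrow> digraph_isomorphism (pullback h G) G h"
  by (simp add: digraph_isomorphism_def)

lemma digraph_iso_pullback_iff:
  assumes "bij h"
  shows "digraph_iso (pullback h G) (pullback h H) \<longleftrightarrow> digraph_iso G H"
  unfolding digraph_iso_def
  using digraph_isomorphism_pullback[OF assms] digraph_isomorphism_inv digraph_isomorphism_comp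
  by meson

lemma digraph_pullback: "digraph G \<Longrightarrow> digraph (pullback h G)"
  by (simp add: digraph_def)

lemma vertex_transitive_pullback:
  assumes "bij h" "vertex_transitive G"
  shows "vertex_transitive (pullback h G)"
  unfolding vertex_transitive_def
proof (intro allI)
  fix x y
  obtain \<pi> where \<pi>: "digraph_isomorphism G G \<pi>" "\<pi> (h x) = h y"
    using assms(2) unfolding vertex_transitive_def by blast
  note h = digraph_isomorphism_pullback[OF assms(1), of G]
  have "digraph_isomorphism (pullback h G) (pullback h G) (inv h \<circ> (\<pi> \<circ> h))"
    using h \<pi>(1) by (meson digraph_isomorphism_comp digraph_isomorphism_inv)
  moreover have "(inv h \<circ> (\<pi> \<circ> h)) x = y"
    using \<pi>(2) assms(1) by (simp add: bij_is_inj)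
  ultimately show "\<exists>\<pi>. digraph_isomorphism (pullback h G) (pullback h G) \<pi> \<and> \<pi> x = y"
    by blast
qed

lemma weakly_connected_pullback:
  assumes "bij h" "weakly_connected G"
  shows "weakly_connected (pullback h G)"
  unfolding weakly_connected_def
proof (intro allI)
  fix x y
  let ?R = "\<lambda>u v. pullback h G (u, v) \<or> pullback h G (v, u)"
  have "?R\<^sup>*\<^sup>* (inv h a) (inv h b)" if "(\<lambda>u v. G (u, v) \<or> G (v, u))\<^sup>*\<^sup>* a b" for a b
    using that
  proof induction
    case (step b c)
    then have "?R (inv h b) (inv h c)"
      using assms(1) by (simp add: bij_is_surj surj_f_inv_f)
    with step.IH show ?case
      by (rule rtranclp.rtrancl_into_rtrancl)
  qed simp
  from this[of "h x" "h y"] show "?R\<^sup>*\<^sup>* x y"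
    using assms by (simp add: weakly_connected_def bij_is_inj)
qed

section \<open>Cayley digraphs of free abelian groups\<close>

text \<open>The augmentation homomorphism, read off from the free abelian group on one point. It
  tells the two sorts of generators apart: 1 on basis elements, 0 on edge differences.\<close>

definition frag_sum :: "('v \<Rightarrow>\<^sub>0 int) \<Rightarrow> int" where
  "frag_sum p = Poly_Mapping.lookup (frag_extend (\<lambda>_. frag_of ()) p) ()"

lemma frag_sum_of [simp]: "frag_sum (frag_of x) = 1"
  by (simp add: frag_sum_def)

lemma frag_sum_diff [simp]: "frag_sum (p - q) = frag_sum p - frag_sum q"
  by (simp add: frag_sum_def frag_extend_diff lookup_minus)

lemma frag_sum_minus [simp]: "frag_sum (- p) = - frag_sum p"
  by (simp add: frag_sum_def frag_extend_minus)

definition generators :: "('v \<times> 'v \<Rightarrow> bool) \<Rightarrow> ('v \<Rightarrow>\<^sub>0 int) set" where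
  "generators \<Gamma> = range frag_of \<union> {frag_of y - frag_of x | x y. \<Gamma> (x, y)}"

definition cayley :: "('v \<times> 'v \<Rightarrow> bool) \<Rightarrow> ('v \<Rightarrow>\<^sub>0 int) \<times> ('v \<Rightarrow>\<^sub>0 int) \<Rightarrow> bool" where
  "cayley \<Gamma> = (\<lambda>(p, q). q - p \<in> generators \<Gamma>)"

lemma cayley_apply [simp]: "cayley \<Gamma> (p, q) \<longleftrightarrow> q - p \<in> generators \<Gamma>"
  by (simp add: cayley_def)

lemma frag_of_in_generators [simp]: "frag_of x \<in> generators \<Gamma>"
  by (simp add: generators_def)

lemma diff_in_generators [intro]: "\<Gamma> (x, y) \<Longrightarrow> frag_of y - frag_of x \<in> generators \<Gamma>"
  by (auto simp: generators_def)

lemma generators_cases: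
  assumes "p \<in> generators \<Gamma>"
  obtains (vertex) x where "p = frag_of x" | (edge) x y where "p = frag_of y - frag_of x" "\<Gamma> (x, y)"
  using assms by (auto simp: generators_def)

lemma generators_frag_sum: "p \<in> generators \<Gamma> \<Longrightarrow> frag_sum p = 0 \<or> frag_sum p = 1"
  by (auto simp: generators_def)

text \<open>Since \<open>a \<noteq> b\<close>, the coefficients at \<open>a\<close> and
  \<open>b\<close> are 1 and -1, which determines \<open>c\<close> and \<open>d\<close>.\<close>

lemma frag_of_diff_eqD:
  assumes "frag_of a - frag_of b = frag_of c - frag_of d" "a \<noteq> b"
  shows "a = c" "b = d"
proof -
  have *: "Poly_Mapping.lookup (frag_of a - frag_of b) k = Poly_Mapping.lookup (frag_of c - frag_of d) k" for k
    using assms(1) by simp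
  show "a = c" "b = d"
    using *[of a] *[of b] assms(2) by (auto simp: lookup_minus split: if_splits)
qed

text \<open>Augmentation 0 rules out a basis element. Irreflexivity makes the ends of an edge
  distinct, so its difference determines the edge.\<close>

lemma diff_in_generators_iff:
  assumes "digraph \<Gamma>"
  shows "frag_of y - frag_of x \<in> generators \<Gamma> \<longleftrightarrow> \<Gamma> (x, y)"
proof
  assume "frag_of y - frag_of x \<in> generators \<Gamma>"
  then show "\<Gamma> (x, y)"
  proof (cases rule: generators_cases)
    case (vertex z)
    from arg_cong[OF this, of frag_sum] show ?thesis by simp
  next
    case (edge a b)
    with assms have "b \<noteq> a" by (auto simp: digraph_def)
    with frag_of_diff_eqD[OF edge(1)[symmetric]] edge(2) show ?thesis by simp
  qed
qed auto

text \<open>It suffices that 0 is not a generator and that no generator has a generator as its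
  negative. The negative of a basis element has augmentation -1; the negative of an edge difference
  would give the reversed edge.\<close>

lemma digraph_cayley:
  assumes "digraph \<Gamma>"
  shows "digraph (cayley \<Gamma>)"
proof -
  have z: "0 \<notin> generators \<Gamma>"
    \<comment> \<open>Any vertex serves here: its basis element minus itself is 0.\<close>
    using diff_in_generators_iff[OF assms, of undefined undefined] assms by (simp add: digraph_def)
  have False if p: "p \<in> generators \<Gamma>" "- p \<in> generators \<Gamma>" for p
    using p(1)
  proof (cases rule: generators_cases)
    case (vertex x)
    with generators_frag_sum[OF p(2)] show False
      by simp
  next
    case (edge x y)
    then have "\<Gamma> (y, x)"
      using p(2) diff_in_generators_iff[OF assms, of x y] by simp
    with edge assms show False by (auto simp: digraph_def)
  qed
  from this[of "q - p" for p q] z show ?thesis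
    by (auto simp: digraph_def)
qed

section \<open>Symmetry, connectedness and functoriality of Cayley digraphs\<close>

lemma translation_cayley: "digraph_isomorphism (cayley \<Gamma>) (cayley \<Gamma>) (\<lambda>p. p + c)"
proof -
  have "bij (\<lambda>p. p + c)" by (rule bij_betw_byWitness[where f' = "\<lambda>p. p - c"]) auto
  then show ?thesis by (simp add: digraph_isomorphism_def)
qed

lemma vertex_transitive_cayley: "vertex_transitive (cayley \<Gamma>)"
  unfolding vertex_transitive_def
proof (intro allI)
  fix p q
  show "\<exists>\<pi>. digraph_isomorphism (cayley \<Gamma>) (cayley \<Gamma>) \<pi> \<and> \<pi> p = q"
    by (intro exI[of _ "\<lambda>r. r + (q - p)"]) (simp add: translation_cayley)
qed

lemma weakly_connected_cayley: "weakly_connected (cayley \<Gamma>)"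
proof -
  let ?R = "\<lambda>u v. cayley \<Gamma> (u, v) \<or> cayley \<Gamma> (v, u)"
  \<comment> \<open>Both signs are proved together because subtracting \<open>a - b\<close> means
    subtracting \<open>a\<close> and adding \<open>b\<close>.\<close>
  have *: "?R\<^sup>*\<^sup>* p (p + q) \<and> ?R\<^sup>*\<^sup>* p (p - q)" for p q :: "'a \<Rightarrow>\<^sub>0 int"
    using subset_UNIV[of "Poly_Mapping.keys q"]
  proof (induction q arbitrary: p rule: frag_induction)
    case (one x)
    have "?R p (p + frag_of x)" "?R p (p - frag_of x)" by simp_all
    then show ?case by blast
  next
    case (diff a b)
    have "?R\<^sup>*\<^sup>* p (p + a)" "?R\<^sup>*\<^sup>* (p + a) (p + a - b)" "?R\<^sup>*\<^sup>* p (p - a)" "?R\<^sup>*\<^sup>* (p - a) (p - a + b)"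
      using diff by blast+
    then have "?R\<^sup>*\<^sup>* p (p + a - b)" "?R\<^sup>*\<^sup>* p (p - a + b)"
      by (meson rtranclp_trans)+
    then show ?case by (simp add: algebra_simps)
  qed auto
  show ?thesis
    unfolding weakly_connected_def
  proof (intro allI)
    fix p q
    show "?R\<^sup>*\<^sup>* p q" using *[of p "q - p"] by simp
  qed
qed

lemma frag_extend_frag_of_bij:
  assumes "bij \<pi>"
  shows "bij (frag_extend (frag_of \<circ> \<pi>))"
proof (rule bij_betw_byWitness[where f' = "frag_extend (frag_of \<circ> inv \<pi>)"])
  have "frag_of \<circ> inv \<pi> \<circ> \<pi> = frag_of" "frag_of \<circ> \<pi> \<circ> inv \<pi> = frag_of"
    using assms by (auto simp: fun_eq_iff bij_is_inj bij_is_surj surj_f_inv_f)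
  then show "\<forall>a\<in>UNIV. frag_extend (frag_of \<circ> inv \<pi>) (frag_extend (frag_of \<circ> \<pi>) a) = a"
    "\<forall>a\<in>UNIV. frag_extend (frag_of \<circ> \<pi>) (frag_extend (frag_of \<circ> inv \<pi>) a) = a"
    by (simp_all only: frag_extend_compose frag_expansion[symmetric] ball_UNIV simp_thms)
qed auto

text \<open>The induced group isomorphism carries one generating set onto the other, and adjacency
  depends only on differences.\<close>

lemma digraph_isomorphism_cayley:
  assumes "digraph_isomorphism \<Gamma> \<Delta> \<pi>"
  shows "digraph_isomorphism (cayley \<Gamma>) (cayley \<Delta>) (frag_extend (frag_of \<circ> \<pi>))"
proof -
  let ?f = "frag_extend (frag_of \<circ> \<pi>)"
  have \<pi>: "bij \<pi>" "\<And>x y. \<Gamma> (x, y) = \<Delta> (\<pi> x, \<pi> y)"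
    using assms by (auto simp: digraph_isomorphism_def)
  have f: "bij ?f"
    using \<pi>(1) by (rule frag_extend_frag_of_bij)
  have "?f ` generators \<Gamma> = generators \<Delta>"
  proof (intro equalityI subsetI)
    fix q assume "q \<in> ?f ` generators \<Gamma>"
    then show "q \<in> generators \<Delta>"
      using \<pi>(2) by (auto simp: generators_def frag_extend_diff)
  next
    fix q assume "q \<in> generators \<Delta>"
    then show "q \<in> ?f ` generators \<Gamma>"
    proof (cases rule: generators_cases)
      case (vertex y)
      then have "q = ?f (frag_of (inv \<pi> y))"
        using \<pi>(1) by (simp add: bij_is_surj surj_f_inv_f)
      then show ?thesis by (metis frag_of_in_generators imageI)
    next
      case (edge x y)
      then have "q = ?f (frag_of (inv \<pi> y) - frag_of (inv \<pi> x))" "\<Gamma> (inv \<pi> x, inv \<pi> y)"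
        using \<pi> by (simp_all add: bij_is_surj surj_f_inv_f frag_extend_diff)
      then show ?thesis by blast
    qed
  qed
  then have "?f q - ?f p \<in> generators \<Delta> \<longleftrightarrow> q - p \<in> generators \<Gamma>" for p q
    using f by (metis (no_types, lifting) frag_extend_diff bij_is_inj inj_image_mem_iff)
  with f show ?thesis by (simp add: digraph_isomorphism_def)
qed

section \<open>Recovering a digraph from its Cayley digraph\<close>

definition transitive_triangle_free :: "('v \<times> 'v \<Rightarrow> bool) \<Rightarrow> bool" where
  "transitive_triangle_free \<Gamma> \<longleftrightarrow> (\<forall>x y z. \<Gamma> (x, y) \<longrightarrow> \<Gamma> (y, z) \<longrightarrow> \<not> \<Gamma> (x, z))"

text \<open>A source with a single out-neighbour has to be excluded, since among the generators it
  would look like an edge difference.\<close>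

definition nonpendant :: "('v \<times> 'v \<Rightarrow> bool) \<Rightarrow> bool" where
  "nonpendant \<Gamma> \<longleftrightarrow> (\<forall>x. (\<exists>z. \<Gamma> (z, x)) \<or> \<not> (\<exists>!y. \<Gamma> (x, y)))"

text \<open>By augmentation such a difference could only be another edge difference. Comparing
  coefficients then leaves two coincidences of endpoints, and each yields a transitive
  triangle.\<close>

lemma edge_generator_no_diff:
  assumes "digraph \<Gamma>" "transitive_triangle_free \<Gamma>" "\<Gamma> (x, y)" "\<Gamma> (u, v)"
  shows "(frag_of v - frag_of u) - (frag_of y - frag_of x) \<notin> generators \<Gamma>" (is "?p \<notin> _")
proof
  assume "?p \<in> generators \<Gamma>"
  then show False
  proof (cases rule: generators_cases)
    case (vertex z)
    from arg_cong[OF this, of frag_sum] show False by simp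
  next
    case (edge a b)
    have *: "Poly_Mapping.lookup ?p k = Poly_Mapping.lookup (frag_of b - frag_of a) k" for k
      using edge(1) by simp
    have ne: "x \<noteq> y" "u \<noteq> v" "a \<noteq> b"
      using assms edge(2) by (auto simp: digraph_def)
    have "v = b \<and> x = u \<and> a = y \<or> v = y \<and> x = b \<and> a = u"
      using *[of v] *[of x] *[of a] *[of b] *[of u] *[of y] ne
      by (auto simp: lookup_minus split: if_splits)
    with assms edge(2) show False
      by (auto simp: transitive_triangle_free_def)
  qed
qed

text \<open>At the vertex \<open>0\<close> of a Cayley digraph this isomorphism-invariant condition separates the generators
  \<open>e\<^sub>x\<close> from the generators \<open>e\<^sub>y - e\<^sub>x\<close>.\<close>

definition base_vertex :: "('v \<times> 'v \<Rightarrow> bool) \<Rightarrow> 'v \<Rightarrow> 'v \<Rightarrow> bool" where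
  "base_vertex G r p \<longleftrightarrow> G (r, p) \<and>
     ((\<exists>t. G (r, t) \<and> G (t, p)) \<or> \<not> (\<exists>!t. G (r, t) \<and> G (p, t)))"

lemma base_vertex_iso:
  assumes "digraph_isomorphism G H \<phi>"
  shows "base_vertex G r p \<longleftrightarrow> base_vertex H (\<phi> r) (\<phi> p)"
proof -
  have \<phi>: "bij \<phi>" "\<And>x y. G (x, y) = H (\<phi> x, \<phi> y)"
    using assms by (auto simp: digraph_isomorphism_def)
  have "(\<exists>t. G (r, t) \<and> G (t, p)) \<longleftrightarrow> (\<exists>t. H (\<phi> r, t) \<and> H (t, \<phi> p))"
    using \<phi> by (metis bij_pointE)
  moreover have "(\<exists>!t. G (r, t) \<and> G (p, t)) \<longleftrightarrow> (\<exists>!t. H (\<phi> r, t) \<and> H (\<phi> p, t))"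
    unfolding \<phi>(2) by (rule bij_Ex1_iff[OF \<phi>(1)])
  ultimately show ?thesis
    by (simp add: base_vertex_def \<phi>(2))
qed

text \<open>An edge difference \<open>frag_of y - frag_of x\<close> has no in-neighbour among the
  generators, and \<open>frag_of y\<close> is its only out-neighbour there, so it fails the
  condition. Around \<open>frag_of x\<close> the basis elements reproduce the arrows at
  \<open>x\<close>, so \<open>nonpendant\<close> yields the condition.\<close>

lemma base_vertex_cayley_iff:
  assumes "digraph \<Gamma>" "transitive_triangle_free \<Gamma>" "nonpendant \<Gamma>"
  shows "base_vertex (cayley \<Gamma>) 0 p \<longleftrightarrow> p \<in> range frag_of"
proof
  assume bv: "base_vertex (cayley \<Gamma>) 0 p"
  then have "p \<in> generators \<Gamma>" by (simp add: base_vertex_def)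
  then show "p \<in> range frag_of"
  proof (cases rule: generators_cases)
    case (edge x y)
    have "x \<noteq> y" using assms(1) edge(2) by (auto simp: digraph_def)
    have no_in: "p - t \<notin> generators \<Gamma>" if t: "t \<in> generators \<Gamma>" for t
      using t
    proof (cases rule: generators_cases)
      case (vertex z)
      then show ?thesis using edge generators_frag_sum[of "p - t"] by auto
    next
      case (edge u v)
      then show ?thesis using \<open>p = _\<close> \<open>\<Gamma> (x, y)\<close> edge_generator_no_diff[OF assms(1,2)] by blast
    qed
    have "t \<in> generators \<Gamma> \<and> t - p \<in> generators \<Gamma> \<longleftrightarrow> t = frag_of y" for t
    proof
      assume t: "t \<in> generators \<Gamma> \<and> t - p \<in> generators \<Gamma>"
      from conjunct1[OF this] show "t = frag_of y"
      proof (cases rule: generators_cases)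
        case (vertex z)
        have "t - p \<in> generators \<Gamma>" using t by blast
        \<comment> \<open>The augmentation of \<open>t - p\<close> is 1, so it is a basis
          element.\<close>
        then obtain w where w: "frag_of z - (frag_of y - frag_of x) = frag_of w"
        proof (cases rule: generators_cases)
          case (edge a b)
          with arg_cong[OF this(1), of frag_sum] vertex \<open>p = _\<close> show ?thesis by simp
        qed (use edge vertex in auto)
        \<comment> \<open>A basis element has no negative coefficient, so \<open>frag_of z\<close>
          must cancel the -1 at \<open>y\<close>.\<close>
        have "Poly_Mapping.lookup (frag_of z - (frag_of y - frag_of x)) y \<ge> 0"
          unfolding w by simp
        with \<open>x \<noteq> y\<close> have "z = y" by (auto simp: lookup_minus split: if_splits)
        with vertex show ?thesis by simp
      next
        case (edge u v)
        then show ?thesis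
          using t \<open>p = _\<close> \<open>\<Gamma> (x, y)\<close> edge_generator_no_diff[OF assms(1,2)] by blast
      qed
    qed (simp add: edge)
    then have "\<exists>!t. t \<in> generators \<Gamma> \<and> t - p \<in> generators \<Gamma>" by simp
    with no_in bv show ?thesis
      unfolding base_vertex_def cayley_apply diff_zero by blast
  qed simp
next
  assume "p \<in> range frag_of"
  then obtain x where x: "p = frag_of x" by blast
  \<comment> \<open>An edge difference cannot be an out-neighbour of \<open>frag_of x\<close>:
    subtracting \<open>frag_of x\<close> from it gives augmentation -1.\<close>
  have edge: "\<exists>y. t = frag_of y \<and> \<Gamma> (x, y)"
    if t: "t \<in> generators \<Gamma>" "t - p \<in> generators \<Gamma>" for t
    using t(1)
  proof (cases rule: generators_cases)
    case (vertex y)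
    then show ?thesis using t(2) x diff_in_generators_iff[OF assms(1)] by auto
  next
    case (edge u v)
    then show ?thesis using t(2) x generators_frag_sum[of "t - p"] by auto
  qed
  consider z where "\<Gamma> (z, x)" | "\<not> (\<exists>!y. \<Gamma> (x, y))"
    using assms(3) unfolding nonpendant_def by blast
  then show "base_vertex (cayley \<Gamma>) 0 p"
  proof cases
    case 1
    then have "p - frag_of z \<in> generators \<Gamma>" unfolding x by blast
    then have "\<exists>t. cayley \<Gamma> (0, t) \<and> cayley \<Gamma> (t, p)"
      by (intro exI[of _ "frag_of z"]) simp
    then show ?thesis by (simp add: base_vertex_def x)
  next
    case 2
    have "\<not> (\<exists>!t. t \<in> generators \<Gamma> \<and> t - p \<in> generators \<Gamma>)"
    proof
      assume "\<exists>!t. t \<in> generators \<Gamma> \<and> t - p \<in> generators \<Gamma>"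
      then obtain t where t: "t \<in> generators \<Gamma>" "t - p \<in> generators \<Gamma>"
        and u: "\<And>s. s \<in> generators \<Gamma> \<Longrightarrow> s - p \<in> generators \<Gamma> \<Longrightarrow> s = t" by blast
      obtain y where y: "t = frag_of y" "\<Gamma> (x, y)" using edge[OF t] by blast
      have "y' = y" if "\<Gamma> (x, y')" for y'
        using u[of "frag_of y'"] y(1) that x by (auto simp: frag_of_eq)
      with y(2) 2 show False by blast
    qed
    then show ?thesis by (simp add: base_vertex_def x)
  qed
qed

lemma digraph_iso_cayley_iff:
  assumes "digraph \<Gamma>" "transitive_triangle_free \<Gamma>" "nonpendant \<Gamma>"
    and "digraph \<Delta>" "transitive_triangle_free \<Delta>" "nonpendant \<Delta>"
  shows "digraph_iso (cayley \<Gamma>) (cayley \<Delta>) \<longleftrightarrow> digraph_iso \<Gamma> \<Delta>"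
proof
  assume "digraph_iso (cayley \<Gamma>) (cayley \<Delta>)"
  then obtain \<phi>0 where \<phi>0: "digraph_isomorphism (cayley \<Gamma>) (cayley \<Delta>) \<phi>0"
    by (auto simp: digraph_iso_def)
  \<comment> \<open>A translation of the target normalises the isomorphism to fix 0, so that it
    preserves the base vertices at 0.\<close>
  define \<phi> where "\<phi> = (\<lambda>p. p + (- \<phi>0 0)) \<circ> \<phi>0"
  have iso: "digraph_isomorphism (cayley \<Gamma>) (cayley \<Delta>) \<phi>"
    unfolding \<phi>_def by (rule digraph_isomorphism_comp[OF \<phi>0 translation_cayley])
  have zero: "\<phi> 0 = 0" by (simp add: \<phi>_def)
  have \<phi>: "bij \<phi>" "\<And>p q. cayley \<Gamma> (p, q) = cayley \<Delta> (\<phi> p, \<phi> q)"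
    using iso by (auto simp: digraph_isomorphism_def)
  have range: "p \<in> range frag_of \<longleftrightarrow> \<phi> p \<in> range frag_of" for p
    using base_vertex_iso[OF iso, of 0 p] base_vertex_cayley_iff assms zero by metis
  then have "\<exists>y. \<phi> (frag_of x) = frag_of y" for x by blast
  then obtain \<psi> where \<psi>: "\<And>x. \<phi> (frag_of x) = frag_of (\<psi> x)" by metis
  have "inj \<psi>"
    using \<psi> \<phi>(1) by (metis bij_is_inj frag_of_eq injD injI)
  moreover have "surj \<psi>"
  proof (rule surjI)
    fix y
    obtain p where p: "\<phi> p = frag_of y" using \<phi>(1) by (metis bij_pointE)
    with range[of p] have "\<exists>x. p = frag_of x" by auto
    with p \<psi> show "\<psi> (SOME x. \<psi> x = y) = y"
      by (metis (mono_tags, lifting) frag_of_eq someI_ex)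
  qed
  moreover have "\<Gamma> (x, y) = \<Delta> (\<psi> x, \<psi> y)" for x y
    using \<phi>(2)[of "frag_of x" "frag_of y"] assms(1,4) by (simp add: \<psi> diff_in_generators_iff)
  ultimately have "digraph_isomorphism \<Gamma> \<Delta> \<psi>"
    by (simp add: digraph_isomorphism_def bij_def)
  then show "digraph_iso \<Gamma> \<Delta>" by (auto simp: digraph_iso_def)
next
  assume "digraph_iso \<Gamma> \<Delta>"
  then show "digraph_iso (cayley \<Gamma>) (cayley \<Delta>)"
    using digraph_isomorphism_cayley by (auto simp: digraph_iso_def)
qed

lemma countable_frag: "countable (UNIV :: ('v::countable \<Rightarrow>\<^sub>0 int) set)"
proof -
  \<comment> \<open>An element is determined by its graph over its support, a finite subset of a
    countable set.\<close>
  let ?g = "\<lambda>p :: 'v \<Rightarrow>\<^sub>0 int. (\<lambda>k. (k, Poly_Mapping.lookup p k)) ` Poly_Mapping.keys p"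
  have "inj ?g"
  proof
    fix p q assume eq: "?g p = ?g q"
    \<comment> \<open>This decodes the finite graph; the default 0 is the coefficient outside the
      support.\<close>
    define val where "val S k = (if \<exists>c. (k, c) \<in> S then THE c. (k, c) \<in> S else 0)"
      for S :: "('v \<times> int) set" and k
    have *: "Poly_Mapping.lookup r k = val (?g r) k" for r k
      by (auto simp: val_def in_keys_iff image_iff)
    show "p = q"
    proof (rule poly_mapping_eqI)
      fix k
      show "Poly_Mapping.lookup p k = Poly_Mapping.lookup q k"
        using *[of p k] *[of q k] eq by argo
    qed
  qed
  moreover have "countable (range ?g)"
    by (rule countable_subset[OF _ countable_Collect_finite]) auto
  ultimately show ?thesis by (rule countable_image_inj_on[rotated])
qed

text \<open>The integer multiples of one basis element are already pairwise distinct.\<close>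

lemma infinite_frag: "infinite (UNIV :: ('v \<Rightarrow>\<^sub>0 int) set)"
proof -
  have "inj (Poly_Mapping.single (undefined :: 'v) :: int \<Rightarrow> _)"
    by (metis injI lookup_single_eq)
  then show ?thesis
    by (metis infinite_UNIV_int finite_imageD finite_subset subset_UNIV)
qed

lemma frag_enumeration:
  obtains h :: "nat \<Rightarrow> ('v::countable \<Rightarrow>\<^sub>0 int)" where "bij h"
  using bij_betw_from_nat_into[OF countable_frag infinite_frag] by blast

section \<open>Coding structures by digraphs\<close>

datatype node = Elem nat | Slot nat nat | Tuple "nat list" | Mark nat

instance node :: countable
  by countable_datatype

text \<open>\<open>Slot i n\<close> says that the entry at position \<open>i\<close> is \<open>n\<close>. The marks form a rigid path whose even
  members label positions and whose odd members from 5 on label relation symbols. The marks 1 and 3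
  are attached to every tuple, so that no tuple has fewer than two out-neighbours.\<close>

fun code_digraph :: "(nat \<Rightarrow> nat list \<Rightarrow> bool) \<Rightarrow> node \<times> node \<Rightarrow> bool" where
  "code_digraph M (Tuple xs, Slot i n) \<longleftrightarrow> i < length xs \<and> xs ! i = n"
| "code_digraph M (Tuple xs, Mark k) \<longleftrightarrow> odd k \<and> (k < 4 \<or> M (k div 2 - 2) xs)"
| "code_digraph M (Slot i n, Elem m) \<longleftrightarrow> m = n"
| "code_digraph M (Slot i n, Mark k) \<longleftrightarrow> k = 2 * i"
| "code_digraph M (Mark k, Mark l) \<longleftrightarrow> l = Suc k"
| "code_digraph M _ \<longleftrightarrow> False"

lemma digraph_code: "digraph (code_digraph M)"
  unfolding digraph_def
proof (intro conjI allI)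
  fix x y
  show "\<not> code_digraph M (x, x)" by (cases x) auto
  show "\<not> (code_digraph M (x, y) \<and> code_digraph M (y, x))" by (cases x; cases y) auto
qed

text \<open>Parity is what matters: tuples point only to odd marks, slots only to even ones, and
  each mark points to a mark of the other parity.\<close>

lemma transitive_triangle_free_code: "transitive_triangle_free (code_digraph M)"
  unfolding transitive_triangle_free_def
proof (intro allI impI notI)
  fix x y z
  assume "code_digraph M (x, y)" "code_digraph M (y, z)" "code_digraph M (x, z)"
  then show False by (cases x; cases y; cases z) auto
qed

section \<open>Recognising the sorts of nodes by their degrees\<close>

lemma sink_code_iff: "(\<forall>y. \<not> code_digraph M (x, y)) \<longleftrightarrow> x \<in> range Elem"
proof (cases x)
  case (Elem n)
  have "\<not> code_digraph M (Elem n, y)" for y by (cases y) auto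
  with Elem show ?thesis by simp
next
  case (Slot i n)
  have "code_digraph M (x, Elem n)" using Slot by simp
  with Slot show ?thesis by blast
next
  case (Tuple xs)
  have "code_digraph M (x, Mark 1)" using Tuple by simp
  with Tuple show ?thesis by blast
next
  case (Mark k)
  have "code_digraph M (x, Mark (Suc k))" using Mark by simp
  with Mark show ?thesis by blast
qed

lemma unique_out_code_iff: "(\<exists>!y. code_digraph M (x, y)) \<longleftrightarrow> x \<in> range Mark"
proof (cases x)
  case (Elem n)
  have "\<not> code_digraph M (Elem n, y)" for y by (cases y) auto
  with Elem show ?thesis by auto
next
  case (Slot i n)
  have "code_digraph M (x, Elem n)" "code_digraph M (x, Mark (2 * i))" using Slot by simp_all
  with Slot show ?thesis by blast
next
  case (Tuple xs)
  have "code_digraph M (x, Mark 1)" "code_digraph M (x, Mark 3)" using Tuple by simp_all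
  with Tuple show ?thesis by (metis node.distinct(11) node.inject(4) numeral_eq_one_iff rangeE semiring_norm(86))
next
  case (Mark k)
  have "code_digraph M (Mark k, y) \<longleftrightarrow> y = Mark (Suc k)" for y by (cases y) auto
  with Mark show ?thesis by auto
qed

lemma source_code_iff: "(\<forall>y. \<not> code_digraph M (y, x)) \<longleftrightarrow> x \<in> range Tuple"
proof (cases x)
  case (Elem n)
  have "code_digraph M (Slot 0 n, x)" using Elem by simp
  with Elem show ?thesis by blast
next
  case (Slot i n)
  \<comment> \<open>Length \<open>Suc i\<close> is just enough for position \<open>i\<close> to
    exist.\<close>
  have "code_digraph M (Tuple (replicate (Suc i) n), x)"
    using Slot by (simp add: nth_append del: replicate_Suc)
  with Slot show ?thesis by blast
next
  case (Tuple xs)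
  have "\<not> code_digraph M (y, Tuple xs)" for y by (cases y) auto
  with Tuple show ?thesis by simp
next
  case (Mark k)
  have "code_digraph M (Slot 0 0, Mark 0)" by simp
  moreover have "code_digraph M (Mark j, Mark (Suc j))" for j by simp
  ultimately have "\<exists>y. code_digraph M (y, x)" using Mark by (cases k) blast+
  with Mark show ?thesis by blast
qed

text \<open>Sources are tuples, whereas a unique out-neighbour forces a mark.\<close>

lemma nonpendant_code: "nonpendant (code_digraph M)"
  unfolding nonpendant_def
proof
  fix x
  show "(\<exists>z. code_digraph M (z, x)) \<or> \<not> (\<exists>!y. code_digraph M (x, y))"
    using source_code_iff[of M x] unfolding unique_out_code_iff by auto
qed

section \<open>Isomorphisms of codes and of structures\<close>

lemma code_iso_of_struct_iso:
  assumes "bij \<pi>" "\<And>k xs. M k xs = N k (map \<pi> xs)"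
  shows "digraph_iso (code_digraph M) (code_digraph N)"
proof -
  define \<phi> where "\<phi> \<rho> x = (case x of Elem n \<Rightarrow> Elem (\<rho> n) | Slot i n \<Rightarrow> Slot i (\<rho> n)
    | Tuple xs \<Rightarrow> Tuple (map \<rho> xs) | Mark k \<Rightarrow> Mark k)" for \<rho> x
  have inv: "inv \<pi> (\<pi> n) = n" "\<pi> (inv \<pi> n) = n" for n
    using assms(1) by (simp_all add: bij_is_inj bij_is_surj surj_f_inv_f)
  have "bij (\<phi> \<pi>)"
    by (rule bij_betw_byWitness[where f' = "\<phi> (inv \<pi>)"])
      (auto simp: \<phi>_def inv comp_def split: node.splits)
  moreover have "code_digraph M (x, y) = code_digraph N (\<phi> \<pi> x, \<phi> \<pi> y)" for x y
    using assms(2) bij_is_inj[OF assms(1)]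
    by (cases x; cases y) (auto simp: \<phi>_def inj_eq)
  ultimately show ?thesis
    by (auto simp: digraph_iso_def digraph_isomorphism_def)
qed

text \<open>An isomorphism preserves the sorts and hence fixes every mark. Its action on
  \<open>Elem\<close> nodes is a permutation, which then determines the images of slots and
  tuples.\<close>

lemma struct_iso_of_code_iso:
  assumes "digraph_iso (code_digraph M) (code_digraph N)"
  shows "\<exists>\<pi>. bij \<pi> \<and> (\<forall>k xs. M k xs = N k (map \<pi> xs))"
proof -
  obtain \<phi> where \<phi>: "bij \<phi>" "\<And>x y. code_digraph M (x, y) = code_digraph N (\<phi> x, \<phi> y)"
    using assms by (auto simp: digraph_iso_def digraph_isomorphism_def)
  have ex: "\<exists>x. \<phi> x = y" for y using \<phi>(1) by (metis bij_pointE)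
  have inj: "\<phi> x = \<phi> y \<longleftrightarrow> x = y" for x y using \<phi>(1) by (simp add: bij_is_inj inj_eq)
  have elem: "x \<in> range Elem \<longleftrightarrow> \<phi> x \<in> range Elem" for x
    using sink_code_iff[of M x] sink_code_iff[of N "\<phi> x"] \<phi>(2) ex by metis
  have tuple: "x \<in> range Tuple \<longleftrightarrow> \<phi> x \<in> range Tuple" for x
    using source_code_iff[of M x] source_code_iff[of N "\<phi> x"] \<phi>(2) ex by metis
  have mark: "x \<in> range Mark \<longleftrightarrow> \<phi> x \<in> range Mark" for x
    using unique_out_code_iff[of M x] unique_out_code_iff[of N "\<phi> x"]
      bij_Ex1_iff[OF \<phi>(1), of "\<lambda>y. code_digraph N (\<phi> x, y)"] \<phi>(2) by simp
  have mark_fixed: "\<phi> (Mark k) = Mark k" for k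
  proof (induction k)
    case 0
    obtain m where m: "\<phi> (Mark 0) = Mark m" using mark by blast
    have "m = 0"
    proof (cases m)
      case (Suc l)
      \<comment> \<open>The preimage of the preceding mark would be a mark pointing to
        \<open>Mark 0\<close>.\<close>
      obtain x where x: "\<phi> x = Mark l" using ex by blast
      then obtain i where "x = Mark i" using mark[of x] by auto
      with x m Suc \<phi>(2)[of x "Mark 0"] show ?thesis by simp
    qed
    with m show ?case by simp
  next
    case (Suc k)
    have "code_digraph N (Mark k, \<phi> (Mark (Suc k)))"
      using \<phi>(2)[of "Mark k" "Mark (Suc k)"] Suc.IH by simp
    then show ?case by (cases "\<phi> (Mark (Suc k))") auto
  qed
  have "\<exists>m. \<phi> (Elem n) = Elem m" for n using elem by blast
  then obtain \<pi> where \<pi>: "\<And>n. \<phi> (Elem n) = Elem (\<pi> n)" by metis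
  have "inj \<pi>" using \<pi> inj by (metis injI node.inject(1))
  moreover have "surj \<pi>" using \<pi> ex elem by (metis node.inject(1) rangeE rangeI surj_def)
  ultimately have "bij \<pi>" by (simp add: bij_def)
  \<comment> \<open>A slot is determined by its element and its position mark.\<close>
  have slot: "\<phi> (Slot i n) = Slot i (\<pi> n)" for i n
  proof -
    have "code_digraph N (\<phi> (Slot i n), Elem (\<pi> n))" "code_digraph N (\<phi> (Slot i n), Mark (2 * i))"
      using \<phi>(2)[of "Slot i n" "Elem n"] \<phi>(2)[of "Slot i n" "Mark (2 * i)"] \<pi> mark_fixed by simp_all
    then show ?thesis by (cases "\<phi> (Slot i n)") auto
  qed
  have map: "\<phi> (Tuple xs) = Tuple (map \<pi> xs)" for xs
  proof -
    obtain ys where ys: "\<phi> (Tuple xs) = Tuple ys" using tuple by blast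
    have *: "(i < length xs \<and> xs ! i = n) \<longleftrightarrow> (i < length ys \<and> ys ! i = \<pi> n)" for i n
      using \<phi>(2)[of "Tuple xs" "Slot i n"] slot ys by simp
    \<comment> \<open>The entry to use is \<open>xs ! i\<close> in one direction, and a preimage of
      \<open>ys ! i\<close> in the other.\<close>
    have "i < length xs \<longleftrightarrow> i < length ys" for i
      using * \<open>surj \<pi>\<close> by (metis surjD)
    then have "length xs = length ys" by (metis linorder_neqE_nat less_irrefl)
    with * have "ys = map \<pi> xs" by (intro nth_equalityI) (auto simp del: not_less)
    with ys show ?thesis by simp
  qed
  \<comment> \<open>Symbol \<open>k\<close> belongs to the odd mark \<open>2 * k + 5\<close>; the
    shift skips the marks 1 and 3.\<close>
  have "M k xs = N k (map \<pi> xs)" for k xs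
    using \<phi>(2)[of "Tuple xs" "Mark (2 * (k + 2) + 1)"] by (simp add: map mark_fixed)
  with \<open>bij \<pi>\<close> show ?thesis by blast
qed

section \<open>The reduction\<close>

text \<open>Numbering the symbols makes the code independent of the language and its
  arities.\<close>

definition relations :: "'r set \<Rightarrow> ('r \<Rightarrow> nat) \<Rightarrow> ('r \<times> nat list \<Rightarrow> bool) \<Rightarrow> nat \<Rightarrow> nat list \<Rightarrow> bool" where
  "relations L ar A k xs \<longleftrightarrow> (\<exists>R\<in>L. to_nat_on L R = k \<and> length xs = ar R \<and> A (R, xs))"

lemma relations_to_nat_on:
  assumes "countable L" "R \<in> L"
  shows "relations L ar A (to_nat_on L R) xs \<longleftrightarrow> length xs = ar R \<and> A (R, xs)"
  using assms by (auto simp: relations_def)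

lemma struct_iso_iff_relations:
  assumes "countable L"
  shows "struct_iso L ar A B \<longleftrightarrow>
    (\<exists>\<pi>. bij \<pi> \<and> (\<forall>k xs. relations L ar A k xs = relations L ar B k (map \<pi> xs)))"
proof -
  have "(\<forall>R\<in>L. \<forall>xs. length xs = ar R \<longrightarrow> A (R, xs) = B (R, map \<pi> xs)) \<longleftrightarrow>
    (\<forall>k xs. relations L ar A k xs = relations L ar B k (map \<pi> xs))" (is "?l \<longleftrightarrow> ?r") for \<pi>
  proof
    assume ?l
    then show ?r by (fastforce simp: relations_def)
  next
    assume r: ?r
    show ?l
    proof (intro ballI allI impI)
      fix R and xs :: "nat list" assume "R \<in> L" "length xs = ar R"
      then show "A (R, xs) = B (R, map \<pi> xs)"
        using r relations_to_nat_on[OF assms, of R ar] by (metis length_map)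
    qed
  qed
  then show ?thesis by (simp add: struct_iso_def)
qed

section \<open>Borel measurability and the final assembly\<close>

lemma measurable_relations:
  assumes "countable L"
  shows "Measurable.pred (Mod L ar) (\<lambda>A. relations L ar A k xs)"
proof (cases "\<exists>R\<in>L. to_nat_on L R = k \<and> length xs = ar R")
  case True
  then obtain R where R: "R \<in> L" "to_nat_on L R = k" "length xs = ar R" by blast
  then have "(R, xs) \<in> atoms L ar" by (simp add: atoms_def)
  then have "(\<lambda>A. A (R, xs)) \<in> measurable (Mod L ar) (count_space UNIV)"
    unfolding Mod_def by (rule measurable_component_singleton)
  with R relations_to_nat_on[OF assms R(1)] show ?thesis by simp
next
  case False
  then have "\<not> relations L ar A k xs" for A by (auto simp: relations_def)
  then show ?thesis by simp
qed

lemma measurable_code_digraph: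
  assumes "\<And>k xs. Measurable.pred S (\<lambda>A. M A k xs)"
  shows "Measurable.pred S (\<lambda>A. code_digraph (M A) (x, y))"
  using assms by (cases x; cases y) simp_all

text \<open>As the vertex type is countable, membership in the generating set is a countable
  disjunction of measurable conditions.\<close>

lemma measurable_cayley:
  fixes \<Gamma> :: "'a \<Rightarrow> 'v::countable \<times> 'v \<Rightarrow> bool"
  assumes "\<And>x y. Measurable.pred S (\<lambda>A. \<Gamma> A (x, y))"
  shows "Measurable.pred S (\<lambda>A. cayley (\<Gamma> A) (p, q))"
proof -
  have "cayley (\<Gamma> A) (p, q) \<longleftrightarrow>
    (\<exists>x. q - p = frag_of x) \<or> (\<exists>x y. q - p = frag_of y - frag_of x \<and> \<Gamma> A (x, y))" for A
    by (auto simp: generators_def)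
  then show ?thesis using assms by simp
qed

theorem theorem2p1:
  fixes L :: "'r set" and ar :: "'r \<Rightarrow> nat"
  assumes "countable L"
  shows "\<exists>f. f \<in> measurable (Mod L ar) digraph_space \<and>
           (\<forall>A \<in> space (Mod L ar). weakly_connected (f A) \<and> vertex_transitive (f A)) \<and>
           (\<forall>A \<in> space (Mod L ar). \<forall>B \<in> space (Mod L ar).
              struct_iso L ar A B \<longleftrightarrow> digraph_iso (f A) (f B))"
proof -
  \<comment> \<open>One enumeration of the group, fixed for all structures, puts every Cayley
    digraph on the naturals.\<close>
  obtain h :: "nat \<Rightarrow> (node \<Rightarrow>\<^sub>0 int)" where h: "bij h"
    by (rule frag_enumeration)
  define \<Gamma> where "\<Gamma> A = code_digraph (relations L ar A)" for A
  define f where "f A = pullback h (cayley (\<Gamma> A))" for A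
  have \<Gamma>: "digraph (\<Gamma> A)" "transitive_triangle_free (\<Gamma> A)" "nonpendant (\<Gamma> A)" for A
    by (simp_all add: \<Gamma>_def digraph_code transitive_triangle_free_code nonpendant_code)
  have "Measurable.pred (Mod L ar) (\<lambda>A. \<Gamma> A (x, y))" for x y
    unfolding \<Gamma>_def by (rule measurable_code_digraph[OF measurable_relations[OF assms]])
  then have "Measurable.pred (Mod L ar) (\<lambda>A. f A e)" for e
    by (cases e) (simp add: f_def measurable_cayley del: cayley_apply)
  then have "f \<in> measurable (Mod L ar) (PiM UNIV (\<lambda>_. count_space UNIV))"
    by (intro measurable_PiM_single') auto
  moreover have "digraph (f A)" for A
    unfolding f_def by (intro digraph_pullback digraph_cayley \<Gamma>)
  ultimately have "f \<in> measurable (Mod L ar) digraph_space"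
    unfolding digraph_space_def by (intro measurable_restrict_space2) auto
  moreover have "weakly_connected (f A)" "vertex_transitive (f A)" for A
    unfolding f_def
    by (simp_all add: weakly_connected_pullback vertex_transitive_pullback h
        weakly_connected_cayley vertex_transitive_cayley)
  moreover have "struct_iso L ar A B \<longleftrightarrow> digraph_iso (f A) (f B)" for A B
  proof -
    have "digraph_iso (f A) (f B) \<longleftrightarrow> digraph_iso (\<Gamma> A) (\<Gamma> B)"
      unfolding f_def by (simp add: digraph_iso_pullback_iff h digraph_iso_cayley_iff \<Gamma>)
    also have "\<dots> \<longleftrightarrow> struct_iso L ar A B"
      unfolding \<Gamma>_def struct_iso_iff_relations[OF assms]
      using code_iso_of_struct_iso struct_iso_of_code_iso by metis
    finally show ?thesis by blast
  qed
  ultimately show ?thesis by blast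
qed

end
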